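(* Let $N\ge 2$ and $m>N$ be integers, and let $K_{\min}(N,m)$ denote the number of distinct values among $\{r_x\}_{x\in\mathcal A(m,N)}$. Then the minimal-order linear recursion with constant coefficients annihilating the sequence $(V_n(N,m))_{n\ge 1}$ has order exactly $K_{\min}(N,m)$.
   Context: For integers $m>N\ge 2$ put $\mathcal A(m,N):=\{x=(x_1,\dots,x_{N-1})\in\mathbb Z^{N-1}: 0<x_1<\cdots<x_{N-1}<m\}$, with the convention $x_0:=0$. For $x\in\mathcal A(m,N)$ put $$r_x:=\prod_{0\le a<b\le N-1}4\sin^2\frac{\pi(x_b-x_a)}{m},$$ and for $n\ge 1$ define the Verlinde sum $$V_n(N,m):=2\,(Nm^{N-1})^n\sum_{x\in\mathcal A(m,N)}r_x^{-n}.$$ A linear recursion with constant coefficients of order $d$ annihilating $(V_n)_{n\ge1}$ is a relation $V_n=\sum_{i=1}^{d}c_iV_{n-i}$ with constants $c_i\in\mathbb C$, $c_d\neq0$, valid for all $n>d$. *)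

theory Defs
  imports "HOL-Analysis.Analysis"
begin

(* A tuple (x_1, ..., x_{N-1}) is the list [x_1, ..., x_{N-1}]. *)
definition alcove :: "nat \<Rightarrow> nat \<Rightarrow> int list set" where
  "alcove m N = {x. length x = N - 1 \<and> sorted_wrt (<) x \<and> (\<forall>j\<in>set x. 0 < j \<and> j < int m)}"

(* Prepending 0 realises the convention x_0 = 0: (0 # x) ! a is x_a for 0 \<le> a \<le> N - 1. *)
definition verlinde_r :: "nat \<Rightarrow> nat \<Rightarrow> int list \<Rightarrow> real" where
  "verlinde_r m N x =
     (\<Prod>b\<le>N - 1. \<Prod>a<b. 4 * (sin (pi * of_int ((0 # x) ! b - (0 # x) ! a) / real m))\<^sup>2)"

definition verlinde_sum :: "nat \<Rightarrow> nat \<Rightarrow> nat \<Rightarrow> real" where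
  "verlinde_sum N m n =
     2 * (real N * real m ^ (N - 1)) ^ n * (\<Sum>x\<in>alcove m N. verlinde_r m N x powi (- int n))"

(* Sequences are indexed by n \<ge> 1; the value V 0 is never used, since n - i \<ge> 1 below.
   For d = 0 the sum is empty and c 0 is otherwise unconstrained, so order 0 means that
   V n = 0 for all n \<ge> 1. *)
definition has_linear_recursion :: "(nat \<Rightarrow> complex) \<Rightarrow> nat \<Rightarrow> bool" where
  "has_linear_recursion V d \<longleftrightarrow>
     (\<exists>c :: nat \<Rightarrow> complex. c d \<noteq> 0 \<and> (\<forall>n>d. V n = (\<Sum>i=1..d. c i * V (n - i))))"

definition is_minimal_recursion_order :: "(nat \<Rightarrow> complex) \<Rightarrow> nat \<Rightarrow> bool" where
  "is_minimal_recursion_order V d \<longleftrightarrow>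
     has_linear_recursion V d \<and> (\<forall>d'. has_linear_recursion V d' \<longrightarrow> d \<le> d')"

definition K_min :: "nat \<Rightarrow> nat \<Rightarrow> nat" where
  "K_min N m = card (verlinde_r m N ` alcove m N)"

end

(* Grouping the Verlinde sum by the values r of r_x gives V_n = \<Sum> w_l l^n, where
   l = N m^(N-1) / r runs over K_min distinct nonzero numbers and the weights w_l (twice the
   multiplicities) are nonzero. A recursion with coefficients c_1, ..., c_d annihilates such a
   sequence iff every l is a root of X^d - \<Sum> c_i X^(d-i), because distinct geometric sequences
   are linearly independent. Hence d is at least the number of values l, and the polynomial
   \<Prod> (X - l) attains it. *)
theory Submission
  imports Defs "HOL-Computational_Algebra.Polynomial"
begin

text \<open>Linear independence of distinct geometric sequences. By linearity the powers
  \<open>l ^ k\<close> may be replaced by any polynomial, and a Lagrange-type polynomial vanishing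
  on \<open>S\<close> except at one point isolates a single weight.\<close>

lemma power_sum_coeffs_eq_0:
  fixes w :: "'a::field \<Rightarrow> 'a"
  assumes "finite S" and power_sums: "\<And>k. (\<Sum>l\<in>S. w l * l ^ k) = 0" and "l \<in> S"
  shows "w l = 0"
proof -
  have poly_sum: "(\<Sum>l\<in>S. w l * poly p l) = 0" for p
  proof -
    have "(\<Sum>l\<in>S. w l * poly p l) = (\<Sum>l\<in>S. \<Sum>i\<le>degree p. coeff p i * (w l * l ^ i))"
      by (simp add: poly_altdef sum_distrib_left algebra_simps)
    also have "\<dots> = (\<Sum>i\<le>degree p. coeff p i * (\<Sum>l\<in>S. w l * l ^ i))"
      by (subst sum.swap) (simp add: sum_distrib_left)
    finally show ?thesis by (simp add: power_sums)
  qed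
  define p where "p = (\<Prod>k\<in>S - {l}. [:- k, 1:])"
  have "poly p k = 0" if "k \<in> S - {l}" for k
    using that \<open>finite S\<close> by (auto simp: p_def poly_prod)
  then have "(\<Sum>k\<in>S. w k * poly p k) = w l * poly p l"
    using assms by (simp add: sum.remove)
  moreover have "poly p l \<noteq> 0"
    using \<open>finite S\<close> by (auto simp: p_def poly_prod)
  ultimately show ?thesis using poly_sum[of p] by simp
qed

lemma has_linear_recursion_card:
  fixes S :: "complex set"
  assumes "finite S" "0 \<notin> S" and V: "\<And>n. n \<ge> 1 \<Longrightarrow> V n = (\<Sum>l\<in>S. w l * l ^ n)"
  shows "has_linear_recursion V (card S)"
proof -
  define d where "d = card S"
  define p where "p = (\<Prod>l\<in>S. [:- l, 1:])"
  have deg: "degree p = d"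
    by (simp add: p_def d_def degree_prod_sum_eq)
  have lead: "coeff p d = 1"
    using lead_coeff_prod[of "\<lambda>l. [:- l, 1:]" S] deg by (simp add: p_def)
  have "poly p 0 \<noteq> 0"
    using assms(1,2) by (auto simp: p_def poly_prod)
  then have c0: "coeff p 0 \<noteq> 0" by (simp add: poly_0_coeff_0)
  \<comment> \<open>Solving \<open>poly p l = 0\<close> for the leading power \<open>l ^ d\<close>
    gives these coefficients. The last one, \<open>c d\<close>, is minus the constant term of
    \<open>p\<close>, which is nonzero because \<open>0\<close> is not a root.\<close>
  define c where "c i = - coeff p (d - i)" for i
  have root: "l ^ d = (\<Sum>i=1..d. c i * l ^ (d - i))" if "l \<in> S" for l
  proof -
    have "0 = poly p l" using that \<open>finite S\<close> by (auto simp: p_def poly_prod)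
    also have "\<dots> = l ^ d + (\<Sum>i<d. coeff p i * l ^ i)"
      by (simp add: poly_altdef deg lead flip: lessThan_Suc_atMost)
    also have "(\<Sum>i<d. coeff p i * l ^ i) = (\<Sum>i=1..d. coeff p (d - i) * l ^ (d - i))"
      by (rule sum.reindex_bij_witness[of _ "\<lambda>i. d - i" "\<lambda>i. d - i"]) auto
    finally show ?thesis by (simp add: c_def sum_negf eq_neg_iff_add_eq_0)
  qed
  have "V n = (\<Sum>i=1..d. c i * V (n - i))" if "n > d" for n
  proof -
    have "V n = (\<Sum>l\<in>S. w l * l ^ (n - d) * l ^ d)"
      using that by (simp add: V mult.assoc flip: power_add)
    also have "\<dots> = (\<Sum>l\<in>S. \<Sum>i=1..d. c i * (w l * (l ^ (n - d) * l ^ (d - i))))"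
      by (simp add: root sum_distrib_left mult_ac)
    also have "\<dots> = (\<Sum>i=1..d. \<Sum>l\<in>S. c i * (w l * l ^ (n - i)))"
      using that by (subst sum.swap) (simp flip: power_add)
    \<comment> \<open>From \<open>n > d\<close> and \<open>i \<le> d\<close> follows
      \<open>n - i \<ge> 1\<close>, the range where \<open>V\<close> is known to be a power
      sum.\<close>
    also have "\<dots> = (\<Sum>i=1..d. c i * V (n - i))"
      using that by (intro sum.cong refl) (auto simp: V sum_distrib_left Suc_le_eq)
    finally show ?thesis .
  qed
  moreover have "c d \<noteq> 0" using c0 by (simp add: c_def)
  ultimately show ?thesis unfolding has_linear_recursion_def d_def by blast
qed

text \<open>The recursion forces every element of \<open>S\<close> to be a root of its monic
  characteristic polynomial, which has at most \<open>d\<close> roots.\<close>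

lemma card_le_linear_recursion_order:
  fixes S :: "complex set"
  assumes "finite S" "0 \<notin> S" and w: "\<And>l. l \<in> S \<Longrightarrow> w l \<noteq> 0"
    and V: "\<And>n. n \<ge> 1 \<Longrightarrow> V n = (\<Sum>l\<in>S. w l * l ^ n)"
    and "has_linear_recursion V d"
  shows "card S \<le> d"
proof -
  obtain c where c: "\<And>n. n > d \<Longrightarrow> V n = (\<Sum>i=1..d. c i * V (n - i))"
    using assms(5) unfolding has_linear_recursion_def by blast
  define q where "q = monom 1 d - (\<Sum>i=1..d. monom (c i) (d - i))"
  have q: "poly q l = l ^ d - (\<Sum>i=1..d. c i * l ^ (d - i))" for l
    by (simp add: q_def poly_sum poly_monom)
  \<comment> \<open>The subtracted monomials have degree \<open>d - i < d\<close> since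
    \<open>i \<ge> 1\<close>; for \<open>d = 0\<close> there are none and \<open>q\<close> is the
    constant 1.\<close>
  have "coeff q d = 1"
    by (auto simp: q_def coeff_sum intro!: sum.neutral)
  then have "q \<noteq> 0" by auto
  have "degree q \<le> d"
    unfolding q_def
    by (intro degree_diff_le degree_sum_le) (auto intro: degree_monom_le order.trans[OF degree_monom_le])
  \<comment> \<open>This is the recursion at index \<open>d + Suc k\<close>. The first admissible
    index is \<open>d + 1\<close>, whence the extra factor \<open>l\<close> in the weights; it
    cancels later because \<open>0 \<notin> S\<close>.\<close>
  have "(\<Sum>l\<in>S. (w l * l * poly q l) * l ^ k) = 0" for k
  proof -
    have "(\<Sum>i=1..d. c i * V (d + Suc k - i)) = (\<Sum>i=1..d. \<Sum>l\<in>S. c i * (w l * l ^ (d + Suc k - i)))"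
      by (intro sum.cong refl) (auto simp: V sum_distrib_left Suc_le_eq)
    also have "\<dots> = (\<Sum>l\<in>S. w l * l ^ Suc k * (\<Sum>i=1..d. c i * l ^ (d - i)))"
    proof (subst sum.swap, rule sum.cong[OF refl])
      fix l :: complex
      have "l ^ (d + Suc k - i) = l ^ Suc k * l ^ (d - i)" if "i \<in> {1..d}" for i
        unfolding power_add[symmetric] using that by (intro arg_cong[where f = "(^) l"]) auto
      then show "(\<Sum>i=1..d. c i * (w l * l ^ (d + Suc k - i)))
          = w l * l ^ Suc k * (\<Sum>i=1..d. c i * l ^ (d - i))"
        unfolding sum_distrib_left by (intro sum.cong refl) (simp only: mult_ac)
    qed
    finally have "V (d + Suc k) = (\<Sum>l\<in>S. w l * l ^ Suc k * (\<Sum>i=1..d. c i * l ^ (d - i)))"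
      by (simp add: c)
    then show ?thesis
      by (simp add: V q algebra_simps power_add sum_subtractf)
  qed
  then have "w l * l * poly q l = 0" if "l \<in> S" for l
    using power_sum_coeffs_eq_0[OF \<open>finite S\<close> _ that, of "\<lambda>l. w l * l * poly q l"] by blast
  then have "S \<subseteq> {l. poly q l = 0}"
    using w \<open>0 \<notin> S\<close> by auto
  then have "card S \<le> card {l. poly q l = 0}"
    using \<open>q \<noteq> 0\<close> by (intro card_mono poly_roots_finite)
  also have "\<dots> \<le> d"
    using card_poly_roots_bound[OF \<open>q \<noteq> 0\<close>] \<open>degree q \<le> d\<close> by linarith
  finally show ?thesis .
qed

lemma is_minimal_recursion_order_card:
  fixes S :: "complex set"
  assumes "finite S" "0 \<notin> S" "\<And>l. l \<in> S \<Longrightarrow> w l \<noteq> 0"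
    and "\<And>n. n \<ge> 1 \<Longrightarrow> V n = (\<Sum>l\<in>S. w l * l ^ n)"
  shows "is_minimal_recursion_order V (card S)"
  unfolding is_minimal_recursion_order_def
  using has_linear_recursion_card[of S V w] card_le_linear_recursion_order[of S w V] assms
  by blast

lemma finite_alcove: "finite (alcove m N)"
  by (rule finite_subset[OF _ finite_lists_length_eq[of "{0<..<int m}" "N - 1"]])
     (auto simp: alcove_def)

text \<open>With \<open>x_0 = 0\<close>, the differences \<open>x_b - x_a\<close> for
  \<open>a < b\<close> lie strictly between 0 and \<open>m\<close>, so every sine is taken at an
  angle in the open interval from 0 to \<open>pi\<close>.\<close>

lemma verlinde_r_nonzero:
  assumes "x \<in> alcove m N" "N \<ge> 1"
  shows "verlinde_r m N x \<noteq> 0"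
proof -
  have x: "length x = N - 1" "sorted_wrt (<) x" "\<And>j. j \<in> set x \<Longrightarrow> 0 < j \<and> j < int m"
    using assms(1) by (auto simp: alcove_def)
  have "sin (pi * of_int ((0 # x) ! b - (0 # x) ! a) / real m) \<noteq> 0" if "a < b" "b \<le> N - 1" for a b
  proof -
    have "sorted_wrt (<) (0 # x)" using x by auto
    then have less: "(0 # x) ! a < (0 # x) ! b"
      by (rule sorted_wrt_nth_less) (use that x(1) in auto)
    \<comment> \<open>As \<open>b > a \<ge> 0\<close>, the entry at \<open>b\<close> is never the
      prepended 0; the entry at \<open>a\<close> may be, so it is only bounded below by 0.\<close>
    have "x ! (b - 1) \<in> set x"
      using that x(1) by (intro nth_mem) auto
    with that have "(0 # x) ! b < int m"
      using x(3) by (auto simp: nth_Cons')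
    moreover have "(0 # x) ! a \<ge> 0"
      using x(1,3) that by (auto simp: nth_Cons' intro!: less_imp_le nth_mem)
    ultimately have "(0 # x) ! b - (0 # x) ! a < int m" by linarith
    then have lt: "real_of_int ((0 # x) ! b - (0 # x) ! a) < real m" by linarith
    have pos: "0 < real_of_int ((0 # x) ! b - (0 # x) ! a)" using less by linarith
    have "pi * real_of_int ((0 # x) ! b - (0 # x) ! a) / real m < pi"
      using lt pos by (simp add: divide_simps)
    moreover have "0 < pi * real_of_int ((0 # x) ! b - (0 # x) ! a) / real m"
      using lt pos by simp
    ultimately show ?thesis using sin_gt_zero by fastforce
  qed
  then show ?thesis by (auto simp: verlinde_r_def)
qed

theorem theorem5p3:
  fixes N m :: nat
  assumes "N \<ge> 2" and "m > N"
  shows "is_minimal_recursion_order (\<lambda>n. complex_of_real (verlinde_sum N m n)) (K_min N m)"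
proof -
  define C where "C = real N * real m ^ (N - 1)"
  define A where "A = alcove m N"
  define g where "g x = complex_of_real (C / verlinde_r m N x)" for x
  define w where "w l = complex_of_nat (2 * card {x \<in> A. g x = l})" for l
  have C: "C \<noteq> 0" using assms by (simp add: C_def)
  have A: "finite A" by (simp add: A_def finite_alcove)
  have r: "verlinde_r m N x \<noteq> 0" if "x \<in> A" for x
    using that assms verlinde_r_nonzero by (simp add: A_def)
  have "is_minimal_recursion_order (\<lambda>n. complex_of_real (verlinde_sum N m n)) (card (g ` A))"
  proof (rule is_minimal_recursion_order_card[where w = w])
    show "finite (g ` A)" using A by simp
    show "0 \<notin> g ` A" using C r by (auto simp: g_def)
    \<comment> \<open>The fibre of \<open>g\<close> over a point of its image is nonempty, and a
      positive natural number stays nonzero in the complex numbers.\<close>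
    show "w l \<noteq> 0" if "l \<in> g ` A" for l
      using that A by (auto simp: w_def)
    fix n :: nat
    have "verlinde_sum N m n = (\<Sum>x\<in>A. 2 * (C / verlinde_r m N x) ^ n)"
      by (simp add: verlinde_sum_def C_def A_def power_int_minus power_mult_distrib power_inverse
          divide_inverse sum_distrib_left mult_ac)
    then have "complex_of_real (verlinde_sum N m n) = (\<Sum>x\<in>A. 2 * g x ^ n)"
      by (simp add: g_def)
    also have "\<dots> = (\<Sum>l\<in>g ` A. \<Sum>x\<in>{x \<in> A. g x = l}. 2 * g x ^ n)"
      by (rule sum.image_gen[OF A])
    also have "\<dots> = (\<Sum>l\<in>g ` A. w l * l ^ n)"
      by (simp add: w_def mult_ac)
    finally show "complex_of_real (verlinde_sum N m n) = (\<Sum>l\<in>g ` A. w l * l ^ n)" .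
  qed
  moreover have "card (g ` A) = K_min N m"
  proof -
    have "g ` A = (\<lambda>r. complex_of_real (C / r)) ` verlinde_r m N ` A"
      by (simp add: g_def image_image)
    \<comment> \<open>Injective on all reals, including \<open>r = 0\<close>, where the quotient is
      0 by convention. Hence counting ratios is the same as counting values of
      \<open>verlinde_r\<close>.\<close>
    moreover have "inj (\<lambda>r. complex_of_real (C / r))"
      using C by (auto simp: inj_def divide_inverse)
    ultimately show ?thesis
      by (simp add: K_min_def A_def card_image inj_on_subset)
  qed
  ultimately show ?thesis by simp
qed

end
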